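(* Every $B$-term $e$ is $\beta\eta$-equivalent to exactly one decreasing polynomial.
   Context: $B=\lambda f.\lambda g.\lambda x.\, f\,(g\,x)$. A $B$-term is a combinatory term built from $B$ alone by application; two $B$-terms are equivalent if their associated $\lambda$-terms are $\beta\eta$-equivalent. Write $e_1\circ e_2$ for $B\,e_1\,e_2$ (associative up to equivalence). Let $B^0B=B$ and $B^{n+1}B=B\,(B^nB)$. A decreasing polynomial is a $B$-term $(B^{n_1}B)\circ(B^{n_2}B)\circ\cdots\circ(B^{n_k}B)$ with $k>0$ and integers $n_1\ge n_2\ge\cdots\ge n_k\ge0$; two decreasing polynomials are the same if they have the same sequence $(n_1,\dots,n_k)$. *)

theory Defs
  imports Main
begin

text \<open>
  Untyped lambda terms in de Bruijn notation: syntactic equality is equality up to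
  renaming of bound variables.
\<close>

datatype lam = Var nat | LApp lam lam | Abs lam

primrec lift :: "lam \<Rightarrow> nat \<Rightarrow> lam" where
  "lift (Var i) k = (if i < k then Var i else Var (Suc i))"
| "lift (LApp s t) k = LApp (lift s k) (lift t k)"
| "lift (Abs s) k = Abs (lift s (Suc k))"

text \<open>
  \<open>subst t u k\<close> replaces the index \<open>k\<close> by \<open>u\<close> and lowers the indices above \<open>k\<close>,
  because the binder of \<open>k\<close> disappears when a beta redex is contracted.
\<close>

primrec subst :: "lam \<Rightarrow> lam \<Rightarrow> nat \<Rightarrow> lam" where
  "subst (Var i) u k = (if k < i then Var (i - 1) else if i = k then u else Var i)"
| "subst (LApp s t) u k = LApp (subst s u k) (subst t u k)"
| "subst (Abs s) u k = Abs (subst s (lift u 0) (Suc k))"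

text \<open>
  In the eta rule, \<open>lift s 0\<close> is the term \<open>s\<close> moved under the binder; the terms of this
  form are those in which the index \<open>0\<close> is not free.
\<close>

inductive beta_eta :: "lam \<Rightarrow> lam \<Rightarrow> bool" where
  beta: "beta_eta (LApp (Abs s) t) (subst s t 0)"
| eta: "beta_eta (Abs (LApp (lift s 0) (Var 0))) s"
| appL: "beta_eta s s' \<Longrightarrow> beta_eta (LApp s t) (LApp s' t)"
| appR: "beta_eta t t' \<Longrightarrow> beta_eta (LApp s t) (LApp s t')"
| xi: "beta_eta s s' \<Longrightarrow> beta_eta (Abs s) (Abs s')"

definition beta_eta_eq :: "lam \<Rightarrow> lam \<Rightarrow> bool" where
  "beta_eta_eq = equivclp beta_eta"

datatype bterm = B | App bterm bterm

primrec lam_of :: "bterm \<Rightarrow> lam" where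
  "lam_of B = Abs (Abs (Abs (LApp (Var 2) (LApp (Var 1) (Var 0)))))"
| "lam_of (App e1 e2) = LApp (lam_of e1) (lam_of e2)"

definition bequiv :: "bterm \<Rightarrow> bterm \<Rightarrow> bool"  (infix \<open>\<approx>\<close> 50) where
  "e1 \<approx> e2 \<longleftrightarrow> beta_eta_eq (lam_of e1) (lam_of e2)"

definition bcomp :: "bterm \<Rightarrow> bterm \<Rightarrow> bterm"  (infixr \<open>\<circ>\<^sub>B\<close> 55) where
  "e1 \<circ>\<^sub>B e2 = App (App B e1) e2"

primrec Bpow :: "nat \<Rightarrow> bterm" where
  "Bpow 0 = B"
| "Bpow (Suc n) = App B (Bpow n)"

text \<open>
  \<open>bpoly [n\<^sub>1, \<dots>, n\<^sub>k]\<close> is the composition of the \<open>Bpow n\<^sub>i\<close>, bracketed to the right. It is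
  meaningful for nonempty lists only.
\<close>

fun bpoly :: "nat list \<Rightarrow> bterm" where
  "bpoly [] = undefined"
| "bpoly [n] = Bpow n"
| "bpoly (n # m # ns) = Bpow n \<circ>\<^sub>B bpoly (m # ns)"

text \<open>
  A decreasing polynomial is \<open>bpoly ns\<close> for a sequence \<open>ns\<close> satisfying the following
  predicate. Two of them are the same if their sequences are equal, so the sequence
  is used to represent the polynomial.
\<close>

definition decreasing :: "nat list \<Rightarrow> bool" where
  "decreasing ns \<longleftrightarrow> ns \<noteq> [] \<and> sorted_wrt (\<ge>) ns"

end

theory Submission
  imports Defs "HOL-Library.Confluence"
begin

text \<open>
  Existence: \<open>App B\<close> distributes over composition, and \<open>B\<^sup>n B \<circ> B\<^sup>m B \<approx> B\<^sup>m\<^sup>+\<^sup>1 B \<circ> B\<^sup>n B\<close> for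
  \<open>n < m\<close>. So an application of polynomials is a composition of powers, and each power can be
  moved into place by insertion.

  Uniqueness: \<open>B\<^sup>n B f\<close> applied to arguments is \<open>f\<close> applied to the same arguments, with those at
  positions \<open>n\<close> and \<open>n + 1\<close> merged into an application. A polynomial applied to enough
  variables thus reduces to an applicative term, which is normal, and by confluence of beta-eta
  reduction the merged argument list is an invariant. If the exponents decrease, they can be
  read off this list, starting from the last one.
\<close>

section \<open>Confluence of beta-eta reduction\<close>

lemma lift_lift: "i \<le> k \<Longrightarrow> lift (lift t i) (Suc k) = lift (lift t k) i"
  by (induction t arbitrary: i k) auto

lemma subst_lift [simp]: "subst (lift t k) u k = t"
  by (induction t arbitrary: k u) auto

lemma subst_lift_Var [simp]: "subst (lift t (Suc k)) (Var k) k = t"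
  by (induction t arbitrary: k) auto

lemma lift_inject [simp]: "lift s k = lift t k \<longleftrightarrow> s = t"
  by (metis subst_lift)

lemma size_lift [simp]: "size (lift t k) = size t"
  by (induction t arbitrary: k) auto

lemma lift_subst:
  "j \<le> k \<Longrightarrow> lift (subst s u j) k = subst (lift s (Suc k)) (lift u k) j"
  by (induction s arbitrary: j k u) (auto simp: lift_lift)

lemma subst_lift_lift:
  "j \<le> k \<Longrightarrow> subst (lift s j) (lift u j) (Suc k) = lift (subst s u k) j"
  by (induction s arbitrary: j k u) (auto simp flip: lift_lift)

lemma subst_subst:
  "j \<le> k \<Longrightarrow>
    subst (subst s t j) u k = subst (subst s (lift u j) (Suc k)) (subst t u k) j"
proof (induction s arbitrary: j k t u)
  case (Abs s)
  then show ?case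
    by (simp add: subst_lift_lift lift_lift)
qed auto

lemma lift_eq_LAppE:
  assumes "lift s k = LApp a b"
  obtains a' b' where "s = LApp a' b'" "a = lift a' k" "b = lift b' k"
  using assms by (cases s) (auto split: if_splits)

lemma lift_eq_AbsE:
  assumes "lift s k = Abs a"
  obtains a' where "s = Abs a'" "a = lift a' (Suc k)"
  using assms by (cases s) (auto split: if_splits)

lemma lift_eq_Var_0 [simp]: "lift s (Suc k) = Var 0 \<longleftrightarrow> s = Var 0"
  by (cases s) auto

text \<open>A converse of \<open>lift_lift\<close>: a term from which two indices are absent can be
  lowered twice. In \<open>par_liftE\<close> it shows that an eta redex in a lifted term comes from
  an eta redex before lifting.\<close>

lemma lift_eq_liftE:
  assumes "lift s (Suc k) = lift t i" "i \<le> k"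
  obtains r where "s = lift r i" "t = lift r k"
proof -
  have "\<exists>r. s = lift r i \<and> t = lift r k"
    using assms
  proof (induction s arbitrary: t i k)
    case (Var x)
    then show ?case
      by (cases t) (auto split: if_splits intro: exI[of _ "Var x"] exI[of _ "Var (x - 1)"])
  next
    case (LApp s1 s2)
    from LApp.prems(1) obtain t1 t2 where
      "t = LApp t1 t2" "lift s1 (Suc k) = lift t1 i" "lift s2 (Suc k) = lift t2 i"
      by (cases t) (auto split: if_splits)
    with LApp.IH[of k] LApp.prems(2) show ?case
      by (metis lift.simps(2))
  next
    case (Abs s)
    from Abs.prems(1) obtain t' where
      "t = Abs t'" "lift s (Suc (Suc k)) = lift t' (Suc i)"
      by (cases t) (auto split: if_splits)
    with Abs.IH[of "Suc k" t' "Suc i"] Abs.prems(2) show ?case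
      by (metis lift.simps(3) Suc_le_mono)
  qed
  with that show thesis by blast
qed

section \<open>Parallel reduction in the style of Tait and Martin-Loef, with beta and eta contracted
  together\<close>

inductive par :: "lam \<Rightarrow> lam \<Rightarrow> bool"  (infix \<open>\<Rrightarrow>\<close> 50) where
  par_Var: "Var i \<Rrightarrow> Var i"
| par_LApp: "s \<Rrightarrow> s' \<Longrightarrow> t \<Rrightarrow> t' \<Longrightarrow> LApp s t \<Rrightarrow> LApp s' t'"
| par_Abs: "s \<Rrightarrow> s' \<Longrightarrow> Abs s \<Rrightarrow> Abs s'"
| par_beta: "s \<Rrightarrow> s' \<Longrightarrow> t \<Rrightarrow> t' \<Longrightarrow> LApp (Abs s) t \<Rrightarrow> subst s' t' 0"
| par_eta: "s \<Rrightarrow> s' \<Longrightarrow> Abs (LApp (lift s 0) (Var 0)) \<Rrightarrow> s'"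

inductive_cases par_VarE [consumes 1]: "Var i \<Rrightarrow> t"
inductive_cases par_LAppE [consumes 1]: "LApp a b \<Rrightarrow> t"
inductive_cases par_AbsE [consumes 1]: "Abs a \<Rrightarrow> t"

lemma par_refl [simp]: "s \<Rrightarrow> s"
  by (induction s) (auto intro: par.intros)

lemma beta_eta_imp_par: "beta_eta s t \<Longrightarrow> s \<Rrightarrow> t"
  by (induction rule: beta_eta.induct) (auto intro: par.intros)

lemma par_lift: "s \<Rrightarrow> t \<Longrightarrow> lift s k \<Rrightarrow> lift t k"
  by (induction arbitrary: k rule: par.induct)
    (auto simp: lift_subst lift_lift intro: par.intros)

lemma par_subst: "s \<Rrightarrow> s' \<Longrightarrow> t \<Rrightarrow> t' \<Longrightarrow> subst s t k \<Rrightarrow> subst s' t' k"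
proof (induction arbitrary: t t' k rule: par.induct)
  case (par_beta s s' b b')
  then show ?case
    by (auto simp: subst_subst[of 0] intro!: par.par_beta par_lift)
next
  case (par_Abs s s')
  then show ?case
    by (auto intro!: par.par_Abs par_lift)
qed (auto simp: subst_lift_lift intro: par.intros)

text \<open>Reduction creates no free indices. Hence the side condition of an eta redex survives
  steps inside it.\<close>

lemma par_liftE:
  assumes "lift s k \<Rrightarrow> t"
  obtains t' where "t = lift t' k" "s \<Rrightarrow> t'"
proof -
  have "\<exists>t'. t = lift t' k \<and> s \<Rrightarrow> t'"
    using assms
  proof (induction "lift s k" t arbitrary: s k rule: par.induct)
    case (par_Var i)
    then show ?case by (metis par_refl)
  next
    case (par_LApp a a' b b')
    from par_LApp.hyps(5) obtain c d where
      s: "s = LApp c d" "a = lift c k" "b = lift d k"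
      by (metis lift_eq_LAppE)
    with par_LApp.hyps(2,4) obtain c' d' where
      "a' = lift c' k" "c \<Rrightarrow> c'" "b' = lift d' k" "d \<Rrightarrow> d'"
      by metis
    with s show ?case
      by (intro exI[of _ "LApp c' d'"]) (simp add: par.par_LApp)
  next
    case (par_Abs a a')
    from par_Abs.hyps(3) obtain c where s: "s = Abs c" "a = lift c (Suc k)"
      by (metis lift_eq_AbsE)
    with par_Abs.hyps(2) obtain c' where "a' = lift c' (Suc k)" "c \<Rrightarrow> c'"
      by metis
    with s show ?case
      by (intro exI[of _ "Abs c'"]) (simp add: par.par_Abs)
  next
    case (par_beta a a' b b')
    from par_beta.hyps(5) obtain c d where
      s: "s = LApp (Abs c) d" "a = lift c (Suc k)" "b = lift d k"
      by (metis lift_eq_LAppE lift_eq_AbsE)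
    with par_beta.hyps(2,4) obtain c' d' where
      "a' = lift c' (Suc k)" "c \<Rrightarrow> c'" "b' = lift d' k" "d \<Rrightarrow> d'"
      by metis
    with s show ?case
      by (intro exI[of _ "subst c' d' 0"]) (simp add: lift_subst par.par_beta)
  next
    case (par_eta q q')
    from par_eta.hyps(3) obtain a where
      s: "s = Abs (LApp a (Var 0))" "lift a (Suc k) = lift q 0"
      by (metis lift_eq_AbsE lift_eq_LAppE lift_eq_Var_0)
    then obtain r where "a = lift r 0" "q = lift r k"
      by (metis lift_eq_liftE le0)
    with s par_eta.hyps(2) show ?case
      by (metis par.par_eta)
  qed
  with that show thesis by blast
qed

text \<open>Besides steps inside \<open>q\<close>, a beta step is possible when \<open>q\<close> is
  an abstraction \<open>Abs d\<close>. That step merely renames the bound variable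
  (\<open>subst_lift_Var\<close>), so its result is a reduct of \<open>d\<close>.\<close>

lemma par_eta_bodyE:
  assumes "LApp (lift q 0) (Var 0) \<Rrightarrow> t"
  obtains q' where "t = LApp (lift q' 0) (Var 0)" "q \<Rrightarrow> q'"
  | d where "q = Abs d" "d \<Rrightarrow> t"
  using assms
proof (cases rule: par_LAppE)
  case (1 a' b')
  then show thesis
    using that(1) by (metis par_liftE par_VarE)
next
  case (2 s s' b')
  then show thesis
    using that(2) by (metis lift_eq_AbsE par_VarE par_liftE subst_lift_Var)
qed

text \<open>
  The induction is on the size rather than on the derivation because the critical pair in
  \<open>beta_app\<close>, an eta redex \<open>\<lambda>x. (\<lambda>y. d) x\<close> in function position, is closed by
  applying the hypothesis to \<open>(\<lambda>y. d) b\<close>, which is not a subterm.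
\<close>

lemma par_diamond:
  "s \<Rrightarrow> t \<Longrightarrow> s \<Rrightarrow> u \<Longrightarrow> \<exists>v. t \<Rrightarrow> v \<and> u \<Rrightarrow> v"
proof (induction "size s" arbitrary: s t u rule: less_induct)
  case less
  have IH: "\<exists>v. t \<Rrightarrow> v \<and> u \<Rrightarrow> v" if "s' \<Rrightarrow> t" "s' \<Rrightarrow> u" "size s' < size s" for s' t u
    using less.hyps that by blast
  have abs_eta: "\<exists>v. Abs a \<Rrightarrow> v \<and> q' \<Rrightarrow> v"
    if s: "s = Abs (LApp (lift q 0) (Var 0))" and a: "LApp (lift q 0) (Var 0) \<Rrightarrow> a"
      and q: "q \<Rrightarrow> q'" for q q' a
    using a
  proof (cases rule: par_eta_bodyE)
    case (1 r)
    with IH[of q r q'] q s show ?thesis by (auto intro: par_eta)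
  next
    \<comment> \<open>Since \<open>q\<close> is \<open>Abs d\<close>, the term \<open>Abs a\<close>
      is itself a reduct of \<open>q\<close>.\<close>
    case (2 d)
    with IH[of q "Abs a" q'] q s show ?thesis by (auto intro: par_Abs)
  qed
  have beta_app: "\<exists>v. subst c' b' 0 \<Rrightarrow> v \<and> LApp a2 b2 \<Rrightarrow> v"
    if s: "s = LApp (Abs c) b" and c: "c \<Rrightarrow> c'" and b: "b \<Rrightarrow> b'" "b \<Rrightarrow> b2"
      and a2: "Abs c \<Rrightarrow> a2" for c c' b b' a2 b2
    using a2
  proof (cases rule: par_AbsE)
    case (1 c2)
    with IH[of c c' c2] IH[of b b' b2] s c b show ?thesis
      by (auto intro: par_beta par_subst)
  next
    case (2 q)
    with c have "LApp (lift q 0) (Var 0) \<Rrightarrow> c'" by simp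
    then show ?thesis
    proof (cases rule: par_eta_bodyE)
      \<comment> \<open>Substitution turns the surviving eta body into
        \<open>LApp r b'\<close>.\<close>
      case (1 r)
      with IH[of q r a2] IH[of b b' b2] s b 2 show ?thesis
        by (auto intro: par_LApp)
    next
      case d: (2 d)
      have "LApp (Abs d) b \<Rrightarrow> subst c' b' 0" "LApp (Abs d) b \<Rrightarrow> LApp a2 b2"
        using d 2 b by (auto intro: par_beta par_LApp)
      with IH s 2 d show ?thesis by force
    qed
  qed
  show ?case
  proof (cases s)
    case (Var i)
    with less.prems show ?thesis by (auto elim!: par_VarE intro: par_Var)
  next
    case s: (Abs a)
    from less.prems(1) show ?thesis unfolding s
    proof (cases rule: par_AbsE)
      case t: (1 a1)
      from less.prems(2) show ?thesis unfolding s
      proof (cases rule: par_AbsE)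
        case (1 a2)
        with t IH[of a a1 a2] s show ?thesis by (auto intro: par_Abs)
      next
        case (2 q)
        with t abs_eta[of q a1 u] s show ?thesis by auto
      qed
    next
      case t: (2 q)
      from less.prems(2) show ?thesis unfolding s
      proof (cases rule: par_AbsE)
        case (1 a2)
        with t abs_eta[of q a2 t] s show ?thesis by auto
      next
        case (2 q')
        with t IH[of q t u] s show ?thesis by auto
      qed
    qed
  next
    case s: (LApp a b)
    from less.prems(1) show ?thesis unfolding s
    proof (cases rule: par_LAppE)
      case t: (1 a1 b1)
      from less.prems(2) show ?thesis unfolding s
      proof (cases rule: par_LAppE)
        case (1 a2 b2)
        with t IH[of a a1 a2] IH[of b b1 b2] s show ?thesis by (auto intro: par_LApp)
      next
        case (2 c c2 b2)
        with t beta_app[of c b c2 b2 b1 a1] s show ?thesis by auto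
      qed
    next
      case t: (2 c c1 b1)
      from less.prems(2) show ?thesis unfolding s
      proof (cases rule: par_LAppE)
        case (1 a2 b2)
        with t beta_app[of c b c1 b1 b2 a2] s show ?thesis by auto
      next
        case (2 c' c2 b2)
        with t IH[of c c1 c2] IH[of b b1 b2] s show ?thesis by (auto intro: par_subst)
      qed
    qed
  qed
qed

text \<open>The Church-Rosser property, from the diamond property by induction on the conversion.
  Joining by \<open>par\<close> is enough because \<open>par\<close> fixes the normal forms compared
  later.\<close>

lemma beta_eta_eq_imp_joinable:
  assumes "beta_eta_eq s t"
  shows "\<exists>u. par\<^sup>*\<^sup>* s u \<and> par\<^sup>*\<^sup>* t u"
proof -
  have "strong_confluentp par"
  proof
    fix x y z
    assume "x \<Rrightarrow> y" "x \<Rrightarrow> z"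
    then obtain u where "y \<Rrightarrow> u" "z \<Rrightarrow> u"
      using par_diamond by blast
    then show "\<exists>u. par\<^sup>*\<^sup>* y u \<and> par\<^sup>=\<^sup>= z u"
      by auto
  qed
  then have conf: "confluentp par"
    by (rule strong_confluentp_imp_confluentp)
  have par: "beta_eta \<le> par"
    by (blast intro: beta_eta_imp_par)
  from assms show ?thesis
    unfolding beta_eta_eq_def
  proof (induction rule: equivclp_induct)
    case base
    then show ?case by blast
  next
    case (step y z)
    then obtain u where u: "par\<^sup>*\<^sup>* s u" "par\<^sup>*\<^sup>* y u" by blast
    from step.hyps(2) par consider "y \<Rrightarrow> z" | "z \<Rrightarrow> y" by blast
    then show ?case
    proof cases
      case 1
      with confluentpD[OF conf u(2), of z] u(1) show ?thesis
        by (meson r_into_rtranclp rtranclp_trans)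
    next
      case 2
      with u show ?thesis
        by (meson converse_rtranclp_into_rtranclp)
    qed
  qed
qed

text \<open>Beta and eta redexes both contain an abstraction, so these terms are normal.\<close>

primrec applicative :: "lam \<Rightarrow> bool" where
  "applicative (Var i) = True"
| "applicative (LApp s t) = (applicative s \<and> applicative t)"
| "applicative (Abs s) = False"

lemma par_applicative: "s \<Rrightarrow> t \<Longrightarrow> applicative s \<Longrightarrow> t = s"
  by (induction rule: par.induct) auto

lemma pars_applicative: "par\<^sup>*\<^sup>* s t \<Longrightarrow> applicative s \<Longrightarrow> t = s"
  by (induction rule: rtranclp_induct) (auto dest: par_applicative)

lemma beta_eta_eq_applicative_iff:
  "applicative s \<Longrightarrow> applicative t \<Longrightarrow> beta_eta_eq s t \<longleftrightarrow> s = t"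
  by (metis beta_eta_eq_imp_joinable pars_applicative beta_eta_eq_def equivclp_refl)

section \<open>Equational theory of B-terms\<close>

lemma beta_eta_eq_refl [simp]: "beta_eta_eq s s"
  by (simp add: beta_eta_eq_def)

lemma beta_eta_eq_sym [sym]: "beta_eta_eq s t \<Longrightarrow> beta_eta_eq t s"
  unfolding beta_eta_eq_def by (rule equivclp_sym)

lemma beta_eta_eq_trans [trans]:
  "beta_eta_eq s t \<Longrightarrow> beta_eta_eq t u \<Longrightarrow> beta_eta_eq s u"
  unfolding beta_eta_eq_def by (rule equivclp_trans)

lemma beta_eta_imp_eq: "beta_eta s t \<Longrightarrow> beta_eta_eq s t"
  unfolding beta_eta_eq_def by (rule r_into_equivclp)

lemma beta_eta_eq_map:
  assumes "beta_eta_eq s t" and "\<And>s t. beta_eta s t \<Longrightarrow> beta_eta (f s) (f t)"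
  shows "beta_eta_eq (f s) (f t)"
  using assms(1) unfolding beta_eta_eq_def
  by (induction rule: equivclp_induct) (auto intro: assms(2) equivclp_into_equivclp)

lemma beta_eta_eq_Abs: "beta_eta_eq s t \<Longrightarrow> beta_eta_eq (Abs s) (Abs t)"
  by (rule beta_eta_eq_map) (auto intro: beta_eta.intros)

lemma beta_eta_eq_LApp:
  assumes "beta_eta_eq s s'" "beta_eta_eq t t'"
  shows "beta_eta_eq (LApp s t) (LApp s' t')"
proof -
  have "beta_eta_eq (LApp s t) (LApp s' t)"
    using assms(1) by (rule beta_eta_eq_map) (rule appL)
  also have "beta_eta_eq \<dots> (LApp s' t')"
    using assms(2) by (rule beta_eta_eq_map) (rule appR)
  finally show ?thesis .
qed

text \<open>Abstracting over the fresh index \<open>0\<close> makes each side an eta redex.\<close>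

lemma beta_eta_eq_ext:
  assumes "beta_eta_eq (LApp (lift s 0) (Var 0)) (LApp (lift t 0) (Var 0))"
  shows "beta_eta_eq s t"
  by (meson assms beta_eta_eq_Abs beta_eta_eq_sym beta_eta_eq_trans beta_eta_imp_eq eta)

lemma lift_lam_of [simp]: "lift (lam_of e) k = lam_of e"
  by (induction e arbitrary: k) auto

text \<open>\<open>B\<close> fires only on three arguments, so laws of B-terms are checked there.
  B-terms are closed and thus unaffected by the lifting in each use of extensionality
  (\<open>lift_lam_of\<close>).\<close>

lemma bequiv_ext3:
  assumes "\<And>x y z. beta_eta_eq (LApp (LApp (LApp (lam_of e) x) y) z)
    (LApp (LApp (LApp (lam_of e') x) y) z)"
  shows "e \<approx> e'"
  unfolding bequiv_def
  by (rule beta_eta_eq_ext, rule beta_eta_eq_ext, rule beta_eta_eq_ext) (simp add: assms)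

lemma B_beta: "beta_eta_eq (LApp (LApp (LApp (lam_of B) f) g) x) (LApp f (LApp g x))"
proof -
  \<comment> \<open>Contracting the second abstraction substitutes \<open>g\<close> below the third
    one, which strips one of the two lifts of \<open>f\<close>.\<close>
  have 1: "subst (lift (lift f 0) 0) (lift g 0) (Suc 0) = lift f 0"
    using subst_lift_lift[of 0 0 "lift f 0" g] by simp
  have "beta_eta_eq (LApp (lam_of B) f)
      (Abs (Abs (LApp (lift (lift f 0) 0) (LApp (Var 1) (Var 0)))))"
    by (rule beta_eta_imp_eq)
      (use beta[of "Abs (Abs (LApp (Var 2) (LApp (Var 1) (Var 0))))" f] in
        \<open>simp add: numeral_2_eq_2\<close>)
  then have "beta_eta_eq (LApp (LApp (lam_of B) f) g)
      (LApp (Abs (Abs (LApp (lift (lift f 0) 0) (LApp (Var 1) (Var 0))))) g)"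
    by (rule beta_eta_eq_LApp) simp
  also have "beta_eta_eq \<dots> (Abs (LApp (lift f 0) (LApp (lift g 0) (Var 0))))"
    by (rule beta_eta_imp_eq)
      (use beta[of "Abs (LApp (lift (lift f 0) 0) (LApp (Var 1) (Var 0)))" g] in \<open>simp add: 1\<close>)
  finally have "beta_eta_eq (LApp (LApp (LApp (lam_of B) f) g) x)
      (LApp (Abs (LApp (lift f 0) (LApp (lift g 0) (Var 0)))) x)"
    by (rule beta_eta_eq_LApp) simp
  also have "beta_eta_eq \<dots> (LApp f (LApp g x))"
    by (rule beta_eta_imp_eq)
      (use beta[of "LApp (lift f 0) (LApp (lift g 0) (Var 0))" x] in simp)
  finally show ?thesis .
qed

section \<open>B-terms up to equivalence, and the laws of composition\<close>

lemma bequiv_refl [simp]: "e \<approx> e"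
  by (simp add: bequiv_def)

lemma bequiv_sym [sym]: "e1 \<approx> e2 \<Longrightarrow> e2 \<approx> e1"
  unfolding bequiv_def by (rule beta_eta_eq_sym)

lemma bequiv_trans [trans]: "e1 \<approx> e2 \<Longrightarrow> e2 \<approx> e3 \<Longrightarrow> e1 \<approx> e3"
  unfolding bequiv_def by (rule beta_eta_eq_trans)

lemma bequiv_App: "e1 \<approx> e1' \<Longrightarrow> e2 \<approx> e2' \<Longrightarrow> App e1 e2 \<approx> App e1' e2'"
  unfolding bequiv_def by (simp add: beta_eta_eq_LApp)

lemma bequiv_bcomp: "e1 \<approx> e1' \<Longrightarrow> e2 \<approx> e2' \<Longrightarrow> e1 \<circ>\<^sub>B e2 \<approx> e1' \<circ>\<^sub>B e2'"
  unfolding bcomp_def by (simp add: bequiv_App)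

text \<open>
  Working with classes turns \<open>B_beta\<close> into an equation that the simplifier can use below
  applications.
\<close>

quotient_type lamq = lam / beta_eta_eq
  by (intro equivpI reflpI sympI transpI) (auto intro: beta_eta_eq_sym beta_eta_eq_trans)

lift_definition qapp :: "lamq \<Rightarrow> lamq \<Rightarrow> lamq" is LApp
  by (rule beta_eta_eq_LApp)

lift_definition qlam_of :: "bterm \<Rightarrow> lamq" is lam_of .

lemma qlam_of_App [simp]: "qlam_of (App e1 e2) = qapp (qlam_of e1) (qlam_of e2)"
  by transfer simp

lemma qapp_B [simp]: "qapp (qapp (qapp (qlam_of B) f) g) x = qapp f (qapp g x)"
  by transfer (rule B_beta)

lemma bequiv_iff_qlam_of: "e1 \<approx> e2 \<longleftrightarrow> qlam_of e1 = qlam_of e2"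
  unfolding bequiv_def by transfer simp

lemma bequiv_qext3:
  assumes "\<And>x y z. qapp (qapp (qapp (qlam_of e) x) y) z = qapp (qapp (qapp (qlam_of e') x) y) z"
  shows "e \<approx> e'"
  by (rule bequiv_ext3) (rule assms[untransferred])

lemma App_bcomp: "App (e1 \<circ>\<^sub>B e2) e3 \<approx> App e1 (App e2 e3)"
  by (simp add: bequiv_iff_qlam_of bcomp_def)

lemma bcomp_assoc: "(e1 \<circ>\<^sub>B e2) \<circ>\<^sub>B e3 \<approx> e1 \<circ>\<^sub>B e2 \<circ>\<^sub>B e3"
  by (rule bequiv_qext3) (simp add: bcomp_def)

lemma App_B_bcomp: "App B (e1 \<circ>\<^sub>B e2) \<approx> App B e1 \<circ>\<^sub>B App B e2"
  by (rule bequiv_qext3) (simp add: bcomp_def)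

text \<open>Both sides send \<open>x\<close>, \<open>y\<close>, \<open>z\<close> to
  \<open>e (x (y z))\<close>. For a power \<open>e\<close> this is the exchange law with
  \<open>n = 0\<close>.\<close>

lemma B_bcomp: "B \<circ>\<^sub>B App B e \<approx> App B (App B e) \<circ>\<^sub>B B"
  by (rule bequiv_qext3) (simp add: bcomp_def)

section \<open>Existence\<close>

text \<open>If \<open>n\<close> is positive, so is \<open>m\<close>, and a common
  \<open>App B\<close> can be pulled out of both sides. This descends to \<open>n = 0\<close>, which
  is \<open>B_bcomp\<close>.\<close>

lemma Bpow_exchange:
  "n < m \<Longrightarrow> Bpow n \<circ>\<^sub>B Bpow m \<approx> Bpow (Suc m) \<circ>\<^sub>B Bpow n"
proof (induction n arbitrary: m)
  case 0
  then show ?case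
    by (cases m) (auto simp: B_bcomp)
next
  case (Suc n)
  then obtain m' where m: "m = Suc m'" "n < m'"
    by (cases m) auto
  have "App B (Bpow n) \<circ>\<^sub>B App B (Bpow m') \<approx> App B (Bpow n \<circ>\<^sub>B Bpow m')"
    by (rule bequiv_sym[OF App_B_bcomp])
  also have "\<dots> \<approx> App B (Bpow (Suc m') \<circ>\<^sub>B Bpow n)"
    using Suc.IH[OF m(2)] by (rule bequiv_App[OF bequiv_refl])
  also have "\<dots> \<approx> App B (Bpow (Suc m')) \<circ>\<^sub>B App B (Bpow n)"
    by (rule App_B_bcomp)
  finally show ?case
    by (simp add: m)
qed

lemma bpoly_Cons: "ns \<noteq> [] \<Longrightarrow> bpoly (n # ns) = Bpow n \<circ>\<^sub>B bpoly ns"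
  by (cases ns) auto

lemma App_B_bpoly: "ns \<noteq> [] \<Longrightarrow> App B (bpoly ns) \<approx> bpoly (map Suc ns)"
proof (induction ns rule: bpoly.induct)
  case (3 n m ns)
  have "App B (bpoly (n # m # ns)) \<approx> App B (Bpow n) \<circ>\<^sub>B App B (bpoly (m # ns))"
    by (simp add: App_B_bcomp)
  also have "\<dots> \<approx> App B (Bpow n) \<circ>\<^sub>B bpoly (map Suc (m # ns))"
    using 3 by (intro bequiv_bcomp) auto
  finally show ?case
    by simp
qed auto

text \<open>The exponents of \<open>Bpow n\<close> composed with a decreasing polynomial: by the
  exchange law, each larger exponent that \<open>n\<close> passes goes up by one.\<close>

primrec insert_exp :: "nat \<Rightarrow> nat list \<Rightarrow> nat list" where
  "insert_exp n [] = [n]"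
| "insert_exp n (m # ms) = (if m \<le> n then n # m # ms else Suc m # insert_exp n ms)"

lemma insert_exp_neq_Nil [simp]: "insert_exp n ms \<noteq> []"
  by (cases ms) auto

text \<open>Passing an exponent raises it by one only, and the new head \<open>Suc m\<close> leaves
  room for that. This keeps the result decreasing.\<close>

lemma insert_exp_bound:
  "x \<in> set (insert_exp n ms) \<Longrightarrow> x \<le> n \<or> (\<exists>y\<in>set ms. x \<le> Suc y)"
  by (induction ms) (auto split: if_splits, fastforce)

lemma decreasing_insert_exp: "decreasing ms \<Longrightarrow> decreasing (insert_exp n ms)"
  unfolding decreasing_def
proof (induction ms)
  case (Cons m ms)
  then show ?case
    by (cases ms) (force dest: insert_exp_bound)+
qed simp

lemma bpoly_insert_exp: "ms \<noteq> [] \<Longrightarrow> Bpow n \<circ>\<^sub>B bpoly ms \<approx> bpoly (insert_exp n ms)"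
proof (induction ms)
  case (Cons m ms)
  show ?case
  proof (cases "m \<le> n \<or> ms = []")
    case True
    then show ?thesis
      using Bpow_exchange[of n m] by (auto simp: bpoly_Cons)
  next
    case False
    then have nm: "n < m" and ms: "ms \<noteq> []" by auto
    have "Bpow n \<circ>\<^sub>B bpoly (m # ms) \<approx> (Bpow n \<circ>\<^sub>B Bpow m) \<circ>\<^sub>B bpoly ms"
      using ms by (simp add: bpoly_Cons bequiv_sym[OF bcomp_assoc])
    also have "\<dots> \<approx> (Bpow (Suc m) \<circ>\<^sub>B Bpow n) \<circ>\<^sub>B bpoly ms"
      by (intro bequiv_bcomp Bpow_exchange nm bequiv_refl)
    also have "\<dots> \<approx> Bpow (Suc m) \<circ>\<^sub>B Bpow n \<circ>\<^sub>B bpoly ms"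
      by (rule bcomp_assoc)
    also have "\<dots> \<approx> Bpow (Suc m) \<circ>\<^sub>B bpoly (insert_exp n ms)"
      by (intro bequiv_bcomp Cons.IH ms bequiv_refl)
    finally show ?thesis
      using nm by (simp add: bpoly_Cons)
  qed
qed simp

text \<open>Applying \<open>B\<close> itself raises every exponent by one. Applying
  \<open>Bpow (Suc k)\<close> is by definition composing with \<open>Bpow k\<close>, which is
  handled by insertion.\<close>

lemma App_Bpow_decreasing:
  assumes "decreasing ns"
  shows "\<exists>ms. decreasing ms \<and> App (Bpow n) (bpoly ns) \<approx> bpoly ms"
proof (cases n)
  case 0
  with assms App_B_bpoly[of ns] show ?thesis
    by (intro exI[of _ "map Suc ns"]) (auto simp: decreasing_def sorted_wrt_map)
next
  case (Suc k)
  with assms bpoly_insert_exp[of ns k] show ?thesis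
    by (intro exI[of _ "insert_exp k ns"])
      (auto simp: decreasing_insert_exp, simp add: decreasing_def bcomp_def)
qed

text \<open>A composition acts on its argument factor by factor, starting with the last one.\<close>

lemma App_bpoly_decreasing:
  "ms \<noteq> [] \<Longrightarrow> decreasing ns \<Longrightarrow>
    \<exists>ls. decreasing ls \<and> App (bpoly ms) (bpoly ns) \<approx> bpoly ls"
proof (induction ms)
  case (Cons m ms)
  show ?case
  proof (cases "ms = []")
    case True
    with App_Bpow_decreasing[OF Cons.prems(2)] show ?thesis by simp
  next
    case False
    with Cons obtain ls where ls: "decreasing ls" "App (bpoly ms) (bpoly ns) \<approx> bpoly ls"
      by blast
    have "App (bpoly (m # ms)) (bpoly ns) \<approx> App (Bpow m) (App (bpoly ms) (bpoly ns))"
      using False by (simp add: bpoly_Cons App_bcomp)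
    also have "\<dots> \<approx> App (Bpow m) (bpoly ls)"
      by (intro bequiv_App ls bequiv_refl)
    finally show ?thesis
      using App_Bpow_decreasing[OF ls(1), of m] by (blast intro: bequiv_trans)
  qed
qed simp

lemma ex_decreasing: "\<exists>ns. decreasing ns \<and> e \<approx> bpoly ns"
proof (induction e)
  case B
  show ?case
    by (intro exI[of _ "[0]"]) (simp add: decreasing_def)
next
  case (App e1 e2)
  then obtain ms ns where
    "decreasing ms" "e1 \<approx> bpoly ms" "decreasing ns" "e2 \<approx> bpoly ns"
    by blast
  then show ?case
    using App_bpoly_decreasing[of ms ns] bequiv_App[of e1 "bpoly ms" e2 "bpoly ns"]
    by (auto simp: decreasing_def intro: bequiv_trans)
qed

section \<open>Uniqueness\<close>

text \<open>The action of \<open>Bpow n\<close> on the arguments after its first. Lists without a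
  position \<open>Suc n\<close> are left unchanged.\<close>

fun merge :: "nat \<Rightarrow> lam list \<Rightarrow> lam list" where
  "merge 0 (x # y # xs) = LApp x y # xs"
| "merge (Suc n) (x # xs) = x # merge n xs"
| "merge _ xs = xs"

text \<open>The outermost factor of a composition acts on the arguments first, hence the left
  fold.\<close>

abbreviation merges :: "lam list \<Rightarrow> nat list \<Rightarrow> lam list" where
  "merges \<equiv> foldl (\<lambda>xs n. merge n xs)"

lemma length_merge: "Suc n < length xs \<Longrightarrow> length (merge n xs) = length xs - 1"
  by (induction n xs rule: merge.induct) auto

text \<open>The entry at \<open>n\<close> is an application whose two sides are the merged entries,
  so a merge at a known position can be undone.\<close>

lemma merge_inject:
  "Suc n < length xs \<Longrightarrow> Suc n < length ys \<Longrightarrow> merge n xs = merge n ys \<Longrightarrow> xs = ys"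
proof (induction n xs arbitrary: ys rule: merge.induct)
  case (1 x y xs)
  then show ?case by (cases "(0::nat, ys)" rule: merge.cases) auto
next
  case (2 n x xs)
  then show ?case by (cases ys) auto
qed auto

lemma nth_merge_less: "i < n \<Longrightarrow> Suc n < length xs \<Longrightarrow> merge n xs ! i = xs ! i"
  by (induction n xs arbitrary: i rule: merge.induct) (auto simp: nth_Cons split: nat.split)

lemma nth_merge_eq: "Suc n < length xs \<Longrightarrow> merge n xs ! n = LApp (xs ! n) (xs ! Suc n)"
  by (induction n xs rule: merge.induct) auto

lemma applicative_merge:
  "\<forall>x\<in>set xs. applicative x \<Longrightarrow> \<forall>x\<in>set (merge n xs). applicative x"
  by (induction n xs rule: merge.induct) auto

lemma applicative_foldl_LApp:
  "applicative f \<Longrightarrow> \<forall>x\<in>set xs. applicative x \<Longrightarrow> applicative (foldl LApp f xs)"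
  by (induction xs arbitrary: f) auto

text \<open>Arguments can be peeled off from the end; a variable is not an application, so both
  spines reach their head together.\<close>

lemma foldl_LApp_inject: "foldl LApp (Var i) xs = foldl LApp (Var i) ys \<Longrightarrow> xs = ys"
proof (induction xs arbitrary: ys rule: rev_induct)
  case Nil
  then show ?case by (cases ys rule: rev_cases) auto
next
  case (snoc x xs)
  then show ?case by (cases ys rule: rev_cases) auto
qed

lemma beta_eta_eq_foldl:
  "beta_eta_eq f g \<Longrightarrow> beta_eta_eq (foldl LApp f xs) (foldl LApp g xs)"
  by (induction xs arbitrary: f g) (auto simp: beta_eta_eq_LApp)

text \<open>Each \<open>App B\<close> lets \<open>f\<close> absorb one argument, since
  \<open>Bpow (Suc n) f x\<close> reduces to \<open>Bpow n (f x)\<close>. The remaining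
  \<open>B\<close> then merges the next two.\<close>

lemma Bpow_merge:
  "Suc n < length xs \<Longrightarrow>
    beta_eta_eq (foldl LApp (LApp (lam_of (Bpow n)) f) xs) (foldl LApp f (merge n xs))"
proof (induction n xs arbitrary: f rule: merge.induct)
  case (1 x y xs)
  show ?case
    using beta_eta_eq_foldl[OF B_beta] by simp
next
  case (2 n x xs)
  have "beta_eta_eq (foldl LApp (LApp (lam_of (Bpow (Suc n))) f) (x # xs))
      (foldl LApp (LApp (lam_of (Bpow n)) (LApp f x)) xs)"
    using beta_eta_eq_foldl[OF B_beta] by simp
  also have "beta_eta_eq \<dots> (foldl LApp (LApp f x) (merge n xs))"
    using 2 by simp
  finally show ?case by simp
qed auto

text \<open>Each merge shortens the list by one; adding \<open>length ns\<close> to the exponents in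
  the bound keeps all later positions in range.\<close>

lemma bpoly_merge:
  "ns \<noteq> [] \<Longrightarrow> \<forall>n\<in>set ns. n + length ns < length xs \<Longrightarrow>
    beta_eta_eq (foldl LApp (LApp (lam_of (bpoly ns)) f) xs)
      (foldl LApp f (merges xs ns))"
proof (induction ns arbitrary: f xs)
  case (Cons n ns)
  show ?case
  proof (cases "ns = []")
    case True
    with Cons.prems show ?thesis by (simp add: Bpow_merge)
  next
    case False
    then have n: "Suc n < length xs"
      using Cons.prems by (cases ns) auto
    have "beta_eta_eq (foldl LApp (LApp (lam_of (bpoly (n # ns))) f) xs)
        (foldl LApp (LApp (lam_of (Bpow n)) (LApp (lam_of (bpoly ns)) f)) xs)"
      using False beta_eta_eq_foldl[OF B_beta] by (simp add: bpoly_Cons bcomp_def)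
    also have "beta_eta_eq \<dots> (foldl LApp (LApp (lam_of (bpoly ns)) f) (merge n xs))"
      by (rule Bpow_merge[OF n])
    also have "beta_eta_eq \<dots> (foldl LApp f (merges (merge n xs) ns))"
      using Cons.prems False n by (intro Cons.IH) (auto simp: length_merge)
    finally show ?thesis by simp
  qed
qed simp

lemma length_merges:
  "\<forall>n\<in>set ns. n + length ns < length xs \<Longrightarrow> length (merges xs ns) = length xs - length ns"
proof (induction ns arbitrary: xs)
  case (Cons m ns)
  then have m: "Suc m < length xs" by auto
  then have "\<forall>n\<in>set ns. n + length ns < length (merge m xs)"
    using Cons.prems by (force simp: length_merge)
  from Cons.IH[OF this] m show ?case by (simp add: length_merge)
qed simp

lemma applicative_merges:
  "\<forall>x\<in>set xs. applicative x \<Longrightarrow> \<forall>x\<in>set (merges xs ns). applicative x"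
proof (induction ns arbitrary: xs)
  case (Cons n ns)
  from Cons.IH[OF applicative_merge[OF Cons.prems]] show ?case by simp
qed simp

lemma nth_merges_less:
  "\<forall>n\<in>set ns. i < n \<and> n + length ns < length xs \<Longrightarrow> merges xs ns ! i = xs ! i"
proof (induction ns arbitrary: xs)
  case (Cons m ns)
  then have m: "i < m" "Suc m < length xs" by auto
  then have "\<forall>n\<in>set ns. i < n \<and> n + length ns < length (merge m xs)"
    using Cons.prems by (force simp: length_merge)
  from Cons.IH[OF this] m show ?case by (simp add: nth_merge_less)
qed simp

text \<open>
  In a decreasing sequence the last exponent is the least one, so it is the position of the
  first entry of the merged list that is not a variable.
\<close>

lemma merges_inject:
  assumes "sorted_wrt (\<ge>) ns" "sorted_wrt (\<ge>) ms"
    and "\<forall>n\<in>set ns. n + length ns < N" "\<forall>n\<in>set ms. n + length ms < N"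
    and "merges (replicate N (Var 0)) ns = merges (replicate N (Var 0)) ms"
  shows "ns = ms"
  using assms
proof (induction ns arbitrary: ms rule: rev_induct)
  case Nil
  have "length (merges (replicate N (Var 0)) ms) = N - length ms"
    using Nil.prems by (subst length_merges) auto
  with Nil.prems show ?case by (cases ms) auto
next
  case (snoc n ns)
  let ?xs = "replicate N (Var 0)"
  have len: "length (merges ?xs ls) = N - length ls" if "\<forall>n\<in>set ls. n + length ls < N" for ls
    using that by (subst length_merges) auto
  \<comment> \<open>The length of the merged list counts the merges, so \<open>ms\<close> cannot be
    empty.\<close>
  have "N - length (ns @ [n]) = N - length ms"
    using len[OF snoc.prems(3)] len[OF snoc.prems(4)] snoc.prems(5) by metis
  moreover have "length (ns @ [n]) < N" using snoc.prems(3) by auto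
  ultimately have "ms \<noteq> []" by auto
  then obtain ms' m where ms: "ms = ms' @ [m]"
    by (cases ms rule: rev_cases) auto
  have last: "Suc k < length (merges ?xs ls) \<and> merges ?xs (ls @ [k]) ! k \<noteq> Var 0 \<and>
      (\<forall>i<k. merges ?xs (ls @ [k]) ! i = Var 0)"
    if sorted: "sorted_wrt (\<ge>) (ls @ [k])"
      and bound: "\<forall>n\<in>set (ls @ [k]). n + length (ls @ [k]) < N" for ls k
  proof -
    have k: "Suc k < length (merges ?xs ls)"
      using bound by (subst len) auto
    have "merges ?xs (ls @ [k]) ! i = Var 0" if i: "i < k" for i
      using sorted bound i by (subst nth_merges_less) (force simp: sorted_wrt_append)+
    with k show ?thesis by (simp add: nth_merge_eq)
  qed
  note last_n = last[OF snoc.prems(1,3)] and last_m = last[OF snoc.prems(2,4)[unfolded ms]]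
  have nm: "n = m"
    using last_n last_m snoc.prems(5) unfolding ms by (metis nat_neq_iff)
  \<comment> \<open>The last merge is at the same position on both sides and can be undone.\<close>
  then have "merges ?xs ns = merges ?xs ms'"
    using last_n last_m snoc.prems(5) unfolding ms by (auto intro: merge_inject)
  moreover have "sorted_wrt (\<ge>) ns" "sorted_wrt (\<ge>) ms'"
      "\<forall>n\<in>set ns. n + length ns < N" "\<forall>n\<in>set ms'. n + length ms' < N"
    using snoc.prems unfolding ms by (auto simp: sorted_wrt_append)
  ultimately have "ns = ms'"
    by (intro snoc.IH)
  with nm ms show ?case by simp
qed

theorem theorem2p10:
  fixes e :: bterm
  shows "\<exists>!ns. decreasing ns \<and> e \<approx> bpoly ns"
proof -
  have "ns = ms"
    if "decreasing ns" "e \<approx> bpoly ns" "decreasing ms" "e \<approx> bpoly ms" for ns ms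
  proof -
    \<comment> \<open>Large enough for the merges of both sequences to stay in range.\<close>
    define N where "N = Suc (sum_list ns + length ns + sum_list ms + length ms)"
    \<comment> \<open>One repeated variable suffices: the exponents are read off from which entries
      have become applications.\<close>
    define xs where "xs = replicate N (Var 0)"
    have ns: "\<forall>n\<in>set ns. n + length ns < N" "ns \<noteq> []"
      and ms: "\<forall>n\<in>set ms. n + length ms < N" "ms \<noteq> []"
      using that member_le_sum_list[of _ ns] member_le_sum_list[of _ ms]
      by (fastforce simp: N_def decreasing_def)+
    have app: "applicative (foldl LApp (Var 0) (merges xs ls))" for ls
      by (intro applicative_foldl_LApp applicative_merges) (auto simp: xs_def)
    have "beta_eta_eq (foldl LApp (Var 0) (merges xs ns))
        (foldl LApp (LApp (lam_of (bpoly ns)) (Var 0)) xs)"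
      using ns by (intro beta_eta_eq_sym[OF bpoly_merge]) (auto simp: xs_def)
    also have "beta_eta_eq \<dots> (foldl LApp (LApp (lam_of (bpoly ms)) (Var 0)) xs)"
      using that unfolding bequiv_def
      by (intro beta_eta_eq_foldl beta_eta_eq_LApp)
        (auto intro: beta_eta_eq_sym beta_eta_eq_trans)
    also have "beta_eta_eq \<dots> (foldl LApp (Var 0) (merges xs ms))"
      using ms by (intro bpoly_merge) (auto simp: xs_def)
    \<comment> \<open>Both ends of the chain are abstraction-free, so their equivalence is equality,
      and a spine determines its arguments.\<close>
    finally have "merges xs ns = merges xs ms"
      using app by (simp add: beta_eta_eq_applicative_iff foldl_LApp_inject)
    with that ns ms show ?thesis
      by (intro merges_inject) (auto simp: xs_def decreasing_def)
  qed
  with ex_decreasing[of e] show ?thesis by blast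
qed

end
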